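(* Let $n\in\mathbb{N}$, $d\in[0,n)$, $\overline{\lambda}\in(0,1)$ and $\lambda\in(0,1)$. Then there exists a constant $\underline{\tau}=\underline{\tau}(n,d,\lambda,\overline{\lambda})\in(0,1)$ such that, for each set $S\in\mathcal{LCR}(d,\lambda)$, any cube $\overline{Q}\subset\mathbb{R}^n$ with $l(\overline{Q})\in(0,1]$ and $\mathcal{H}^{d}_{\infty}(\overline{Q}\cap S)<\overline{\lambda}\,(l(\overline{Q}))^{d}$ is $(S,\underline{\tau})$-porous.
   Context: $\mathbb{R}^n$ carries the norm $\|x\|_\infty=\max_i|x_i|$, and diameters are taken in this norm. A cube is a closed cube with sides parallel to the coordinate axes; $l(Q)$ is its side length. For $x\in\mathbb{R}^n$, $l\ge 0$, $Q_l(x):=\prod_{i=1}^n[x_i-l,x_i+l]$. $d$-Hausdorff content: $\mathcal{H}^d_\infty(E):=\inf\sum_{F\in\mathcal{F}}(\operatorname{diam}F)^d$, the infimum being over all at most countable coverings $\mathcal{F}$ of $E$ by subsets of $\mathbb{R}^n$ with $\sup_{F\in\mathcal F}\operatorname{diam}F<\infty$ (and $\mathcal{H}^d_\infty(\emptyset)=0$; for $d=0$ each nonempty covering set contributes $1$). $\mathcal{LCR}(d,\lambda)$ is the class of all (nonempty) sets $S\subset\mathbb{R}^n$ such that $\mathcal{H}^d_\infty(Q_l(x)\cap S)\ge\lambda l^d$ for all $x\in S$ and all $l\in(0,1]$. For $\tau\in(0,1]$, a cube $Q_l(x)$ is $(S,\tau)$-porous if there is a cube $Q_{l'}(x')\subset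 Q_l(x)\setminus S$ with $l'\ge\tau l$. *)

theory Defs
  imports "HOL-Analysis.Analysis"
begin

text \<open>
  The \<open>norm\<close> of \<open>real ^ 'n\<close> is the Euclidean one, so the diameter for the maximum norm is
  built from \<^const>\<open>infnorm\<close>. It takes the value \<open>\<infinity>\<close> on unbounded sets and \<open>0\<close> on the empty set.
\<close>

definition diam_inf :: "(real ^ 'n) set \<Rightarrow> ennreal" where
  "diam_inf E = (SUP x\<in>E. SUP y\<in>E. ennreal (infnorm (x - y)))"

text \<open>
  The term \<open>(diam F)\<^sup>d\<close> of a covering set. The case distinction is needed because
  \<open>0 powr 0 = 0\<close>, whereas for \<open>d = 0\<close> every nonempty set has to contribute \<open>1\<close>.
  The use of \<^const>\<open>enn2real\<close> is harmless, since only sets of finite diameter are admitted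
  in \<open>hausdorff_content\<close>.
\<close>

definition diam_power :: "real \<Rightarrow> (real ^ 'n) set \<Rightarrow> ennreal" where
  "diam_power d F =
     (if F = {} then 0 else if d = 0 then 1 else ennreal (enn2real (diam_inf F) powr d))"

definition hausdorff_content :: "real \<Rightarrow> (real ^ 'n) set \<Rightarrow> ennreal" where
  "hausdorff_content d E =
     (INF \<F>\<in>{\<F>. countable \<F> \<and> E \<subseteq> \<Union>\<F> \<and> (SUP F\<in>\<F>. diam_inf F) < \<infinity>}.
        \<Sum>\<^sub>\<infinity>F\<in>\<F>. diam_power d F)"

text \<open>\<open>cube x l\<close> is \<open>Q\<^sub>l(x)\<close>; its side length is \<open>2 * l\<close>, not \<open>l\<close>.\<close>

definition cube :: "real ^ 'n \<Rightarrow> real \<Rightarrow> (real ^ 'n) set" where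
  "cube x l = cbox (\<chi> i. x $ i - l) (\<chi> i. x $ i + l)"

definition is_cube :: "(real ^ 'n) set \<Rightarrow> bool" where
  "is_cube Q \<longleftrightarrow> (\<exists>x l. 0 \<le> l \<and> Q = cube x l)"

definition side_length :: "(real ^ 'n) set \<Rightarrow> real" where
  "side_length Q = (THE s. 0 \<le> s \<and> (\<exists>x. Q = cube x (s / 2)))"

definition LCR :: "real \<Rightarrow> real \<Rightarrow> (real ^ 'n) set set" where
  "LCR d lam =
     {S. S \<noteq> {} \<and>
         (\<forall>x\<in>S. \<forall>l\<in>{0<..1}. hausdorff_content d (cube x l \<inter> S) \<ge> ennreal (lam * l powr d))}"

definition porous :: "(real ^ 'n) set \<Rightarrow> real \<Rightarrow> (real ^ 'n) set \<Rightarrow> bool" where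
  "porous S \<tau> Q \<longleftrightarrow>
     (\<exists>x l. 0 \<le> l \<and> Q = cube x l \<and>
        (\<exists>x' l'. 0 \<le> l' \<and> \<tau> * l \<le> l' \<and> cube x' l' \<subseteq> cube x l - S))"

lemma cube_eq_iff:
  fixes x y :: "real ^ 'n"
  assumes "0 \<le> l" "0 \<le> m"
  shows "cube x l = cube y m \<longleftrightarrow> x = y \<and> l = m"
proof
  assume eq: "cube x l = cube y m"
  have ne: "(\<chi> i. x $ i - l) \<in> cube x l" "(\<chi> i. x $ i + l) \<in> cube x l"
    "(\<chi> i. y $ i - m) \<in> cube y m" "(\<chi> i. y $ i + m) \<in> cube y m"
    using assms by (auto simp: cube_def mem_box_cart)
  have "x $ i - l = y $ i - m \<and> x $ i + l = y $ i + m" for i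
    using ne(1,2)[unfolded eq] ne(3,4)[folded eq]
    by (auto simp: cube_def mem_box_cart intro: antisym)
  then have *: "x $ i - l = y $ i - m" "x $ i + l = y $ i + m" for i
    by auto
  have "l = m"
    using *[of undefined] by linarith
  with * show "x = y \<and> l = m"
    by (auto simp: vec_eq_iff)
qed auto

lemma side_length_cube:
  fixes x :: "real ^ 'n"
  assumes "0 \<le> l"
  shows "side_length (cube x l) = 2 * l"
  unfolding side_length_def
proof (rule the_equality)
  show "0 \<le> 2 * l \<and> (\<exists>y. cube x l = cube y (2 * l / 2))"
    using assms by auto
next
  fix s :: real
  assume "0 \<le> s \<and> (\<exists>y. cube x l = cube y (s / 2))"
  then show "s = 2 * l"
    using cube_eq_iff[of l "s / 2" x] assms by auto
qed

end

theory Submission imports Defs begin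

text \<open>
  Divide the cube, of side length \<open>s\<close>, into \<open>M\<^sup>n\<close> cells of side length \<open>\<delta> = s / M\<close>. If it is not
  \<open>(S, 1 / (2 * M))\<close>-porous, the concentric half of every cell meets \<open>S\<close>, so the part of \<open>S\<close> in
  every cell has content at least \<open>m = lam * (\<delta> / 4) powr d\<close>. Given a covering, call a set big if
  its diameter \<open>r\<close> is at least \<open>K * \<delta>\<close>. A set meets at most \<open>(r / \<delta> + 2)\<^sup>n\<close> cells: for
  big sets this is at most \<open>(1 + 2 / K)\<^sup>n * (r / \<delta>)\<^sup>n\<close>, and for the others it is at most
  \<open>(K + 2)\<^sup>n\<close>. Each cell meets a big set, or the small sets that it meets contribute at least \<open>m\<close>.
  Counting cells, the sum of the covering is at least \<open>s powr d\<close> divided by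
  \<open>(1 + 2 / K)\<^sup>n + C * M powr (d - n)\<close> with \<open>C\<close> depending on \<open>K\<close>; as \<open>lambar < 1\<close>, it exceeds
  \<open>lambar * s powr d\<close> once \<open>K\<close> and then \<open>M\<close> are large.
\<close>

section \<open>Cubes, grid cells and the number of cells that a set meets\<close>

lemma mem_cube: "y \<in> cube x l \<longleftrightarrow> (\<forall>i. \<bar>y $ i - x $ i\<bar> \<le> l)"
  by (auto simp: cube_def mem_box_cart abs_le_iff algebra_simps)

lemma component_diff_le_diam_inf:
  fixes x y :: "real ^ 'n"
  assumes "x \<in> F" "y \<in> F" "diam_inf F < \<infinity>"
  shows "\<bar>x $ i - y $ i\<bar> \<le> enn2real (diam_inf F)"
proof -
  have "ennreal (infnorm (x - y)) \<le> diam_inf F"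
    unfolding diam_inf_def by (rule SUP_upper2[OF assms(1)], rule SUP_upper[OF assms(2)])
  then have "infnorm (x - y) \<le> enn2real (diam_inf F)"
    using assms(3) by (metis enn2real_ennreal enn2real_mono infnorm_pos_le infinity_ennreal_def)
  then show ?thesis
    using component_le_infnorm_cart[of "x - y" i] by simp
qed

text \<open>The point \<open>a\<close> is the lower corner of the subdivided cube. Cells are closed
  and share faces, which is harmless: only upper bounds on the number of cells that a set meets are
  used.\<close>

definition grid_cell :: "real ^ 'n \<Rightarrow> real \<Rightarrow> ('n \<Rightarrow> nat) \<Rightarrow> (real ^ 'n) set" where
  "grid_cell a \<delta> k = cube (\<chi> i. a $ i + (real (k i) + 1 / 2) * \<delta>) (\<delta> / 2)"

lemma mem_grid_cell:
  "y \<in> grid_cell a \<delta> k \<longleftrightarrow>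
     (\<forall>i. real (k i) * \<delta> \<le> y $ i - a $ i \<and> y $ i - a $ i \<le> (real (k i) + 1) * \<delta>)"
proof -
  have "\<bar>y $ i - (a $ i + (real (k i) + 1 / 2) * \<delta>)\<bar> \<le> \<delta> / 2 \<longleftrightarrow>
      real (k i) * \<delta> \<le> y $ i - a $ i \<and> y $ i - a $ i \<le> (real (k i) + 1) * \<delta>" for i
    unfolding distrib_right by linarith
  then show ?thesis
    by (simp add: grid_cell_def mem_cube)
qed

definition grid :: "nat \<Rightarrow> ('n::finite \<Rightarrow> nat) set" where
  "grid M = (\<Pi>\<^sub>E i\<in>UNIV. {..<M})"

lemma finite_grid: "finite (grid M)"
  unfolding grid_def by (intro finite_PiE) auto

lemma card_grid: "card (grid M :: ('n::finite \<Rightarrow> nat) set) = M ^ CARD('n)"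
  unfolding grid_def by (simp add: card_PiE)

lemma card_nat_set_le_diameter:
  fixes A :: "nat set"
  assumes "finite A" "0 \<le> D" "\<And>j k. j \<in> A \<Longrightarrow> k \<in> A \<Longrightarrow> real k - real j \<le> D"
  shows "real (card A) \<le> D + 1"
proof (cases "A = {}")
  case False
  have "A \<subseteq> {Min A..Max A}"
    using assms(1) by auto
  then have "card A \<le> Suc (Max A) - Min A"
    by (metis card_atLeastAtMost card_mono finite_atLeastAtMost)
  moreover have "Min A \<le> Max A"
    using assms(1) False by simp
  moreover have "real (Max A) - real (Min A) \<le> D"
    using assms(1,3) False by simp
  ultimately show ?thesis
    by linarith
qed (use assms in simp)

text \<open>The indices of the cells that meet \<open>F\<close> lie in the product of the sets
  \<open>A i\<close> of slabs that \<open>F\<close> touches in direction \<open>i\<close>, so it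
  suffices to bound each \<open>card (A i)\<close>.\<close>

lemma card_grid_cells_meeting_le:
  fixes F :: "(real ^ 'n) set"
  assumes "0 < \<delta>" "diam_inf F < \<infinity>"
  shows "real (card {k \<in> grid M. F \<inter> grid_cell a \<delta> k \<noteq> {}})
           \<le> (enn2real (diam_inf F) / \<delta> + 2) ^ CARD('n)"
proof -
  define r where "r = enn2real (diam_inf F)"
  define A where "A i = {j \<in> {..<M}. \<exists>y\<in>F. real j * \<delta> \<le> y $ i - a $ i
                          \<and> y $ i - a $ i \<le> (real j + 1) * \<delta>}" for i
  have fin: "finite (A i)" for i
    unfolding A_def by auto
  have A: "real (card (A i)) \<le> (r / \<delta> + 1) + 1" for i
  proof (rule card_nat_set_le_diameter[OF fin])
    show "0 \<le> r / \<delta> + 1"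
      using assms(1) by (simp add: r_def add_nonneg_nonneg)
  next
    fix j k assume "j \<in> A i" "k \<in> A i"
    then obtain y z where yz: "y \<in> F" "z \<in> F" "real k * \<delta> \<le> y $ i - a $ i"
      "z $ i - a $ i \<le> (real j + 1) * \<delta>"
      unfolding A_def by auto
    have "\<bar>y $ i - z $ i\<bar> \<le> r"
      unfolding r_def using component_diff_le_diam_inf yz(1,2) assms(2) by blast
    \<comment> \<open>The signed distance from the upper face of slab \<open>j\<close> to the lower
      face of slab \<open>k\<close> is \<open>(k - j - 1) * \<delta>\<close>. This costs one unit,
      and counting both end indices another; hence the summand \<open>2\<close>.\<close>
    then have "(real k - real j - 1) * \<delta> \<le> r"
      using yz(3,4) by (simp add: algebra_simps)
    then show "real k - real j \<le> r / \<delta> + 1"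
      using assms(1) by (simp add: field_simps)
  qed
  have "{k \<in> grid M. F \<inter> grid_cell a \<delta> k \<noteq> {}} \<subseteq> (\<Pi>\<^sub>E i\<in>UNIV. A i)"
    unfolding A_def grid_def by (fastforce simp: mem_grid_cell PiE_iff)
  then have "card {k \<in> grid M. F \<inter> grid_cell a \<delta> k \<noteq> {}} \<le> card (\<Pi>\<^sub>E i\<in>UNIV. A i)"
    by (intro card_mono finite_PiE fin) auto
  also have "\<dots> = (\<Prod>i\<in>UNIV. card (A i))"
    by (simp add: card_PiE)
  finally have "real (card {k \<in> grid M. F \<inter> grid_cell a \<delta> k \<noteq> {}}) \<le> (\<Prod>i\<in>UNIV. real (card (A i)))"
    by (simp flip: of_nat_prod)
  also have "\<dots> \<le> (\<Prod>i\<in>(UNIV :: 'n set). r / \<delta> + 2)"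
    using A by (intro prod_mono) (auto simp: add.commute add.left_commute)
  finally show ?thesis
    by (simp add: r_def)
qed

section \<open>Infinite sums and Hausdorff content\<close>

lemma infsum_cmult_le_ennreal:
  fixes f :: "'a \<Rightarrow> ennreal"
  shows "(\<Sum>\<^sub>\<infinity>x\<in>A. c * f x) \<le> c * infsum f A"
proof (rule infsum_le_finite_sums)
  fix B assume B: "finite B" "B \<subseteq> A"
  have "sum f B = infsum f B"
    using B by simp
  also have "\<dots> \<le> infsum f A"
    using B by (intro infsum_mono_neutral nonneg_summable_on_complete) auto
  finally show "(\<Sum>x\<in>B. c * f x) \<le> c * infsum f A"
    by (simp add: mult_left_mono flip: sum_distrib_left)
qed (simp add: nonneg_summable_on_complete)

lemma sum_infsum_swap_ennreal:
  fixes g :: "'a \<Rightarrow> 'b \<Rightarrow> ennreal"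
  assumes "finite I"
  shows "(\<Sum>k\<in>I. \<Sum>\<^sub>\<infinity>x\<in>A. g k x) = (\<Sum>\<^sub>\<infinity>x\<in>A. \<Sum>k\<in>I. g k x)"
  using assms by (induction I rule: finite_induct) (simp_all add: infsum_add nonneg_summable_on_complete)

lemma hausdorff_content_le_cover:
  assumes "countable \<F>" "E \<subseteq> \<Union>\<F>" "(SUP F\<in>\<F>. diam_inf F) < \<infinity>"
  shows "hausdorff_content d E \<le> (\<Sum>\<^sub>\<infinity>F\<in>\<F>. diam_power d F)"
  unfolding hausdorff_content_def using assms by (intro INF_lower) auto

text \<open>The inequality for \<open>p\<close> lets \<open>d = 0\<close> be treated like the other
  exponents: there \<open>p = 1\<close>, while \<open>0 powr 0 = 0\<close> for a singleton.\<close>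

lemma diam_power_eq_ennreal:
  assumes "F \<noteq> {}"
  obtains p where "diam_power d F = ennreal p" "enn2real (diam_inf F) powr d \<le> p"
proof
  show "diam_power d F = ennreal (if d = 0 then 1 else enn2real (diam_inf F) powr d)"
    using assms by (simp add: diam_power_def)
qed (simp add: powr_def)

section \<open>Weighted count for a single set\<close>

text \<open>Here \<open>N\<close> is the number of cells met by a set of diameter \<open>r\<close>;
  it pays \<open>m\<close> per cell if it is big, and its diameter power \<open>p\<close> otherwise.
  The factor before the final \<open>p\<close> is the same for all sets.\<close>

lemma weighted_cell_count_le:
  fixes N r p s m K d :: real
  assumes "0 < s" "0 < M" "0 < K" "0 \<le> m" "0 \<le> r" "r powr d \<le> p" "0 \<le> d" "d \<le> real n"
    and "0 \<le> N" "N \<le> real M ^ n" "N \<le> (r / (s / M) + 2) ^ n"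
  shows "N * (if K * (s / M) \<le> r then m else p)
           \<le> (m * (1 + 2 / K) ^ n * (real M ^ n / s powr d) + (K + 2) ^ n) * p"
proof -
  define \<delta> where "\<delta> = s / M"
  have \<delta>: "0 < \<delta>"
    using assms by (simp add: \<delta>_def)
  have p: "0 \<le> p"
    using assms(6) powr_ge_zero[of r d] by linarith
  show ?thesis
  proof (cases "K * \<delta> \<le> r")
    case True
    have r: "0 < r"
      using True \<delta> assms(3) by (meson less_le_trans mult_pos_pos)
    \<comment> \<open>If \<open>s \<le> r\<close>, the trivial bound \<open>M ^ n\<close> suffices,
      as \<open>(r / s) powr d\<close> is at least \<open>1\<close>. Otherwise
      \<open>2 \<le> (2 / K) * (r / \<delta>)\<close> gives the bound with exponent
      \<open>n\<close>, which may be lowered to \<open>d\<close> because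
      \<open>r / s < 1\<close>.\<close>
    have N: "N \<le> (1 + 2 / K) ^ n * real M ^ n * (r / s) powr d"
    proof (cases "s \<le> r")
      case True
      have "1 * real M ^ n * 1 \<le> (1 + 2 / K) ^ n * real M ^ n * (r / s) powr d"
        using True assms by (intro mult_mono one_le_power ge_one_powr_ge_zero) auto
      then show ?thesis
        using assms(10) by simp
    next
      case False
      have "r / \<delta> + 2 \<le> (1 + 2 / K) * (r / \<delta>)"
        using True \<delta> assms(3) by (simp add: field_simps)
      then have "(r / \<delta> + 2) ^ n \<le> ((1 + 2 / K) * (r / \<delta>)) ^ n"
        using \<delta> r by (intro power_mono) auto
      also have "\<dots> = (1 + 2 / K) ^ n * real M ^ n * (r / s) ^ n"
        by (simp add: \<delta>_def power_mult_distrib power_divide)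
      also have "(r / s) ^ n = (r / s) powr real n"
        using r assms(1) by (simp add: powr_realpow)
      also have "(1 + 2 / K) ^ n * real M ^ n * (r / s) powr real n
                   \<le> (1 + 2 / K) ^ n * real M ^ n * (r / s) powr d"
        using False r assms by (intro mult_left_mono powr_mono') auto
      finally show ?thesis
        using assms(11) by (simp add: \<delta>_def)
    qed
    have "N * m \<le> (1 + 2 / K) ^ n * real M ^ n * (r / s) powr d * m"
      using N assms(4) by (rule mult_right_mono)
    also have "\<dots> = m * (1 + 2 / K) ^ n * (real M ^ n / s powr d) * r powr d"
      using r assms(1) by (simp add: powr_divide)
    also have "\<dots> \<le> m * (1 + 2 / K) ^ n * (real M ^ n / s powr d) * p"
      using assms by (intro mult_left_mono) auto
    also have "\<dots> \<le> (m * (1 + 2 / K) ^ n * (real M ^ n / s powr d) + (K + 2) ^ n) * p"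
      using assms p by (intro mult_right_mono) auto
    finally show ?thesis
      using True by (simp add: \<delta>_def)
  next
    case False
    have "r / \<delta> + 2 \<le> K + 2"
      using False \<delta> by (simp add: field_simps)
    then have "(r / \<delta> + 2) ^ n \<le> (K + 2) ^ n"
      using \<delta> assms(5) by (intro power_mono) (auto simp: add_nonneg_nonneg)
    then have "N \<le> (K + 2) ^ n"
      using assms(11) by (simp add: \<delta>_def)
    also have "\<dots> \<le> m * (1 + 2 / K) ^ n * (real M ^ n / s powr d) + (K + 2) ^ n"
      using assms by simp
    finally show ?thesis
      using False p by (simp add: \<delta>_def mult_right_mono)
  qed
qed

section \<open>Double counting of cells and covering sets\<close>

text \<open>Each covering set \<open>F\<close> pays \<open>w F\<close> to every cell that it meets.
  Every cell receives at least \<open>m\<close>, while \<open>F\<close> pays at most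
  \<open>A\<close> times its diameter power in total; exchanging the two sums compares the
  totals.\<close>

lemma cover_sum_lower_bound:
  fixes E :: "(real ^ 'n) set"
  assumes "0 \<le> d" "d \<le> real CARD('n)" "0 < s" "0 < M" "0 < K" "0 \<le> m"
    and cells: "\<And>k. k \<in> grid M \<Longrightarrow>
                  ennreal m \<le> hausdorff_content d (E \<inter> grid_cell a (s / M) k)"
    and cover: "countable \<F>" "E \<subseteq> \<Union>\<F>" "(SUP F\<in>\<F>. diam_inf F) < \<infinity>"
  shows "ennreal (real M ^ CARD('n) * m)
           \<le> ennreal (m * (1 + 2 / K) ^ CARD('n) * (real M ^ CARD('n) / s powr d)
                + (K + 2) ^ CARD('n)) * (\<Sum>\<^sub>\<infinity>F\<in>\<F>. diam_power d F)"
proof -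
  define \<delta> where "\<delta> = s / M"
  define big where "big F \<longleftrightarrow> K * \<delta> \<le> enn2real (diam_inf F)" for F :: "(real ^ 'n) set"
  define w where "w F = (if big F then ennreal m else diam_power d F)" for F :: "(real ^ 'n) set"
  define meets where "meets k F \<longleftrightarrow> F \<inter> grid_cell a \<delta> k \<noteq> {}" for k and F :: "(real ^ 'n) set"
  define A where "A = m * (1 + 2 / K) ^ CARD('n) * (real M ^ CARD('n) / s powr d)
                        + (K + 2) ^ CARD('n)"
  have \<delta>: "0 < \<delta>"
    using assms by (simp add: \<delta>_def)
  have cell: "ennreal m \<le> (\<Sum>\<^sub>\<infinity>F\<in>\<F>. if meets k F then w F else 0)" if k: "k \<in> grid M" for k
  proof (cases "\<exists>F\<in>\<F>. meets k F \<and> big F")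
    case True
    then obtain F where F: "F \<in> \<F>" "meets k F" "big F"
      by blast
    have "ennreal m = (\<Sum>\<^sub>\<infinity>G\<in>{F}. if meets k G then w G else 0)"
      using F by (simp add: w_def)
    also have "\<dots> \<le> (\<Sum>\<^sub>\<infinity>G\<in>\<F>. if meets k G then w G else 0)"
      using F by (intro infsum_mono_neutral nonneg_summable_on_complete) auto
    finally show ?thesis .
  next
    case False
    \<comment> \<open>No big set meets this cell, so \<open>w\<close> agrees with
      \<open>diam_power d\<close> on \<G>, which still covers the part of \<open>E\<close> in the
      cell.\<close>
    define \<G> where "\<G> = {F \<in> \<F>. meets k F}"
    have "ennreal m \<le> hausdorff_content d (E \<inter> grid_cell a \<delta> k)"
      using cells[OF k] by (simp add: \<delta>_def)
    also have "\<dots> \<le> (\<Sum>\<^sub>\<infinity>F\<in>\<G>. diam_power d F)"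
    proof (rule hausdorff_content_le_cover)
      show "countable \<G>"
        unfolding \<G>_def using cover(1) by (rule countable_subset[rotated]) auto
      show "E \<inter> grid_cell a \<delta> k \<subseteq> \<Union>\<G>"
        using cover(2) unfolding \<G>_def meets_def by auto
      have "(SUP F\<in>\<G>. diam_inf F) \<le> (SUP F\<in>\<F>. diam_inf F)"
        unfolding \<G>_def by (rule SUP_subset_mono) auto
      then show "(SUP F\<in>\<G>. diam_inf F) < \<infinity>"
        using cover(3) by (rule le_less_trans)
    qed
    also have "\<dots> = (\<Sum>\<^sub>\<infinity>F\<in>\<F>. if meets k F then w F else 0)"
      using False by (intro infsum_cong_neutral) (auto simp: \<G>_def w_def)
    finally show ?thesis .
  qed
  have pointwise: "(\<Sum>k\<in>grid M. if meets k F then w F else 0) \<le> ennreal A * diam_power d F"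
    if F: "F \<in> \<F>" for F
  proof (cases "F = {}")
    case True
    then show ?thesis
      by (simp add: meets_def)
  next
    case False
    then obtain p where p: "diam_power d F = ennreal p" "enn2real (diam_inf F) powr d \<le> p"
      by (rule diam_power_eq_ennreal)
    have p0: "0 \<le> p"
      using p(2) powr_ge_zero order_trans by blast
    have fin: "diam_inf F < \<infinity>"
      using cover(3) SUP_upper[OF F, of diam_inf] by (rule le_less_trans[rotated])
    define N where "N = card {k \<in> grid M. meets k F}"
    have "N \<le> card (grid M :: ('n \<Rightarrow> nat) set)"
      unfolding N_def by (intro card_mono finite_grid) auto
    then have N1: "real N \<le> real M ^ CARD('n)"
      by (simp add: card_grid flip: of_nat_power)
    have N2: "real N \<le> (enn2real (diam_inf F) / (s / M) + 2) ^ CARD('n)"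
      using card_grid_cells_meeting_le[OF \<delta> fin] by (simp add: N_def meets_def \<delta>_def)
    have "(\<Sum>k\<in>grid M. if meets k F then w F else 0) = of_nat N * w F"
      by (simp add: N_def sum.If_cases finite_grid Int_def)
    also have "\<dots> = ennreal (real N * (if K * (s / M) \<le> enn2real (diam_inf F) then m else p))"
      using p0 assms(6) by (simp add: w_def big_def \<delta>_def p(1) ennreal_mult ennreal_of_nat_eq_real_of_nat)
    also have "\<dots> \<le> ennreal (A * p)"
      unfolding A_def
      by (intro ennreal_leI weighted_cell_count_le) (use assms p(2) N1 N2 in auto)
    also have "\<dots> = ennreal A * diam_power d F"
      using p0 assms by (simp add: p(1) A_def ennreal_mult)
    finally show ?thesis .
  qed
  have "ennreal (real M ^ CARD('n) * m) = (\<Sum>k\<in>(grid M :: ('n \<Rightarrow> nat) set). ennreal m)"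
    using assms(6) by (simp add: card_grid ennreal_mult ennreal_of_nat_eq_real_of_nat
        flip: ennreal_power of_nat_power)
  also have "\<dots> \<le> (\<Sum>k\<in>grid M. \<Sum>\<^sub>\<infinity>F\<in>\<F>. if meets k F then w F else 0)"
    by (intro sum_mono cell)
  also have "\<dots> = (\<Sum>\<^sub>\<infinity>F\<in>\<F>. \<Sum>k\<in>grid M. if meets k F then w F else 0)"
    by (rule sum_infsum_swap_ennreal[OF finite_grid])
  also have "\<dots> \<le> (\<Sum>\<^sub>\<infinity>F\<in>\<F>. ennreal A * diam_power d F)"
    by (intro infsum_mono pointwise nonneg_summable_on_complete) auto
  also have "\<dots> \<le> ennreal A * (\<Sum>\<^sub>\<infinity>F\<in>\<F>. diam_power d F)"
    by (rule infsum_cmult_le_ennreal)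
  finally show ?thesis
    by (simp add: A_def)
qed

section \<open>Choice of the parameters\<close>

text \<open>First \<open>K\<close> is fixed with \<open>lambar * (1 + 2 / K) ^ n < 1\<close>; then
  \<open>M\<close> tends to infinity, and the error term vanishes, however large
  \<open>(K + 2) ^ n\<close> is, because \<open>d < n\<close>.\<close>

lemma exists_grid_parameters:
  fixes lambar c d :: real
  assumes "0 < lambar" "lambar < 1" "d < real n"
  obtains K :: real and M :: nat where "0 < K" "0 < M"
    "lambar * ((1 + 2 / K) ^ n + c * (K + 2) ^ n * real M powr (d - real n)) < 1"
proof -
  have "((\<lambda>K. lambar * (1 + 2 / K) ^ n) \<longlongrightarrow> lambar * (1 + 0) ^ n) at_top"
    by (intro tendsto_intros tendsto_divide_0[OF tendsto_const] filterlim_at_top_imp_at_infinity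
        filterlim_ident)
  then have "\<forall>\<^sub>F K in at_top. lambar * (1 + 2 / K) ^ n < 1"
    by (rule order_tendstoD) (use assms in simp)
  then have "\<forall>\<^sub>F K in at_top. lambar * (1 + 2 / K) ^ n < 1 \<and> 0 < K"
    using eventually_gt_at_top[of 0] by (rule eventually_conj)
  then obtain K :: real where K: "lambar * (1 + 2 / K) ^ n < 1" "0 < K"
    using eventually_happens by fastforce
  have "((\<lambda>M. lambar * ((1 + 2 / K) ^ n + c * (K + 2) ^ n * real M powr (d - real n)))
          \<longlongrightarrow> lambar * ((1 + 2 / K) ^ n + c * (K + 2) ^ n * 0)) sequentially"
    using assms(3)
    by (intro tendsto_intros tendsto_neg_powr filterlim_real_sequentially) auto
  then have "\<forall>\<^sub>F M in sequentially.
      lambar * ((1 + 2 / K) ^ n + c * (K + 2) ^ n * real M powr (d - real n)) < 1"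
    by (rule order_tendstoD) (use K in simp)
  then have "\<forall>\<^sub>F M in sequentially.
      lambar * ((1 + 2 / K) ^ n + c * (K + 2) ^ n * real M powr (d - real n)) < 1 \<and> 0 < M"
    using eventually_gt_at_top[of 0] by (rule eventually_conj)
  then obtain M where "lambar * ((1 + 2 / K) ^ n + c * (K + 2) ^ n * real M powr (d - real n)) < 1"
      "0 < M"
    using eventually_happens by fastforce
  with K(2) show ?thesis
    using that by blast
qed

section \<open>Content in the cells of a cube that is not porous\<close>

text \<open>The concentric half of a cell has radius \<open>\<delta> / 4\<close>, exactly
  \<open>1 / (2 * M)\<close> times \<open>l\<close>, so it contains a point \<open>p\<close> of
  \<open>S\<close>. The cube of radius \<open>\<delta> / 4\<close> about \<open>p\<close> stays in
  the cell, and lower regularity applies to it.\<close>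

lemma nonporous_grid_cell_content:
  fixes S :: "(real ^ 'n) set"
  assumes S: "S \<in> LCR d lam" and "0 < l" "l \<le> 1 / 2" "0 < M"
    and np: "\<not> porous S (1 / (2 * real M)) (cube x l)" and k: "k \<in> grid M"
  shows "ennreal (lam * (2 * l / M / 4) powr d)
           \<le> hausdorff_content d (cube x l \<inter> S \<inter> grid_cell (\<chi> i. x $ i - l) (2 * l / M) k)"
proof -
  define \<delta> where "\<delta> = 2 * l / M"
  define z where "z = (\<chi> i. (\<chi> i. x $ i - l) $ i + (real (k i) + 1 / 2) * \<delta>)"
  have \<delta>: "0 < \<delta>" "\<delta> \<le> 1" "\<delta> / 4 = 1 / (2 * real M) * l" "real M * \<delta> = 2 * l"
    using assms(2-4) by (simp_all add: \<delta>_def field_simps)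
  have cell: "grid_cell (\<chi> i. x $ i - l) \<delta> k = cube z (\<delta> / 2)"
    by (simp add: grid_cell_def z_def)
  have cell_sub: "cube z (\<delta> / 2) \<subseteq> cube x l"
  proof
    fix y assume "y \<in> cube z (\<delta> / 2)"
    then have y: "real (k i) * \<delta> \<le> y $ i - (x $ i - l)"
      "y $ i - (x $ i - l) \<le> (real (k i) + 1) * \<delta>" for i
      using cell mem_grid_cell[of y "\<chi> i. x $ i - l" \<delta> k] by simp_all
    have upper: "(real (k i) + 1) * \<delta> \<le> 2 * l" for i
    proof -
      have "k i < M"
        using k by (auto simp: grid_def PiE_iff)
      then have "(real (k i) + 1) * \<delta> \<le> real M * \<delta>"
        using \<delta>(1) by (intro mult_right_mono) auto
      then show ?thesis
        using \<delta>(4) by simp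
    qed
    have lower: "0 \<le> real (k i) * \<delta>" for i
      using \<delta>(1) by simp
    have "x $ i - l \<le> y $ i \<and> y $ i \<le> x $ i + l" for i
      using y[of i] upper[of i] lower[of i] by linarith
    then show "y \<in> cube x l"
      unfolding mem_cube abs_le_iff by (simp add: algebra_simps)
  qed
  have half: "cube z (\<delta> / 4) \<subseteq> cube z (\<delta> / 2)"
  proof
    fix y assume y: "y \<in> cube z (\<delta> / 4)"
    have "\<bar>y $ i - z $ i\<bar> \<le> \<delta> / 2" for i
      using y[unfolded mem_cube, rule_format, of i] \<delta>(1) by linarith
    then show "y \<in> cube z (\<delta> / 2)"
      by (simp add: mem_cube)
  qed
  have "\<not> cube z (\<delta> / 4) \<subseteq> cube x l - S"
  proof
    assume "cube z (\<delta> / 4) \<subseteq> cube x l - S"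
    moreover have "0 \<le> \<delta> / 4" "1 / (2 * real M) * l \<le> \<delta> / 4"
      using \<delta>(1,3) by simp_all
    ultimately have "porous S (1 / (2 * real M)) (cube x l)"
      unfolding porous_def using assms(2) less_imp_le by blast
    then show False
      using np by simp
  qed
  then obtain p where p: "p \<in> S" "p \<in> cube z (\<delta> / 4)"
    using half cell_sub by blast
  have p_sub: "cube p (\<delta> / 4) \<subseteq> cube z (\<delta> / 2)"
  proof
    fix y assume y: "y \<in> cube p (\<delta> / 4)"
    have "\<bar>y $ i - z $ i\<bar> \<le> \<delta> / 2" for i
      using y[unfolded mem_cube, rule_format, of i] p(2)[unfolded mem_cube, rule_format, of i]
      by linarith
    then show "y \<in> cube z (\<delta> / 2)"
      by (simp add: mem_cube)
  qed
  \<comment> \<open>The bound \<open>\<delta> \<le> 1\<close> makes the radius admissible in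
    \<open>LCR\<close>.\<close>
  have "ennreal (lam * (\<delta> / 4) powr d) \<le> hausdorff_content d (cube p (\<delta> / 4) \<inter> S)"
    using S p(1) \<delta>(1,2) by (auto simp: LCR_def)
  also have "\<dots> \<le> hausdorff_content d (cube x l \<inter> S \<inter> cube z (\<delta> / 2))"
    unfolding hausdorff_content_def
    using p_sub cell_sub by (intro INF_superset_mono) auto
  finally show ?thesis
    unfolding \<delta>_def[symmetric] cell .
qed

section \<open>Porosity of cubes with small content\<close>

theorem theorem1p1:
  fixes d lam lambar :: real
  assumes "0 \<le> d" and "d < real CARD('n::finite)"
    and "0 < lambar" and "lambar < 1"
    and "0 < lam" and "lam < 1"
  shows "\<exists>\<tau>. 0 < \<tau> \<and> \<tau> < 1 \<and>
           (\<forall>S :: (real ^ 'n) set. S \<in> LCR d lam \<longrightarrow>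
             (\<forall>Q. is_cube Q \<and> 0 < side_length Q \<and> side_length Q \<le> 1 \<and>
                   hausdorff_content d (Q \<inter> S) < ennreal (lambar * side_length Q powr d)
                \<longrightarrow> porous S \<tau> Q))"
proof -
  let ?n = "CARD('n)"
  \<comment> \<open>Both parameters are fixed before \<open>S\<close> and \<open>Q\<close>. The
    constant \<open>4 powr d / lam\<close> comes from dividing \<open>s powr d\<close> by the
    content bound \<open>lam * (s / M / 4) powr d\<close> of a cell.\<close>
  obtain K M where KM: "0 < K" "0 < M"
    and small: "lambar * ((1 + 2 / K) ^ ?n + 4 powr d / lam * (K + 2) ^ ?n
                  * real M powr (d - real ?n)) < 1"
    using exists_grid_parameters[OF assms(3,4,2)] by blast
  show ?thesis
  proof (intro exI[of _ "1 / (2 * real M)"] conjI allI impI)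
    fix S Q :: "(real ^ 'n) set"
    assume S: "S \<in> LCR d lam"
      and Q: "is_cube Q \<and> 0 < side_length Q \<and> side_length Q \<le> 1 \<and>
                hausdorff_content d (Q \<inter> S) < ennreal (lambar * side_length Q powr d)"
    obtain x l where xl: "Q = cube x l" "0 \<le> l"
      using Q by (auto simp: is_cube_def)
    define s where "s = 2 * l"
    have side: "side_length Q = s"
      using side_length_cube xl by (simp add: s_def)
    have s: "0 < s" "s \<le> 1"
      using Q side by auto
    show "porous S (1 / (2 * real M)) Q"
    proof (rule ccontr)
      assume np: "\<not> porous S (1 / (2 * real M)) Q"
      define m where "m = lam * (s / M / 4) powr d"
      define A where "A = m * (1 + 2 / K) ^ ?n * (real M ^ ?n / s powr d) + (K + 2) ^ ?n"
      have m: "0 < m"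
        using s KM assms by (simp add: m_def)
      have A: "0 < A"
        unfolding A_def using m s KM by (intro add_nonneg_pos) auto
      obtain \<F> where \<F>: "countable \<F>" "Q \<inter> S \<subseteq> \<Union>\<F>" "(SUP F\<in>\<F>. diam_inf F) < \<infinity>"
        and sum: "(\<Sum>\<^sub>\<infinity>F\<in>\<F>. diam_power d F) < ennreal (lambar * s powr d)"
        using Q unfolding side hausdorff_content_def INF_less_iff by blast
      have "ennreal (real M ^ ?n * m) \<le> ennreal A * (\<Sum>\<^sub>\<infinity>F\<in>\<F>. diam_power d F)"
        unfolding A_def
      proof (rule cover_sum_lower_bound[OF _ _ _ _ _ _ _ \<F>])
        show "ennreal m \<le> hausdorff_content d
                (Q \<inter> S \<inter> grid_cell (\<chi> i. x $ i - l) (s / real M) k)" if "k \<in> grid M" for k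
          using nonporous_grid_cell_content[OF S _ _ KM(2) np[unfolded xl(1)] that] s
          by (simp add: m_def s_def xl(1))
      qed (use assms s KM m in auto)
      also have "\<dots> < ennreal A * ennreal (lambar * s powr d)"
        using sum A by (intro ennreal_mult_strict_left_mono) auto
      also have "\<dots> = ennreal (A * (lambar * s powr d))"
        using A assms by (simp add: ennreal_mult)
      finally have less: "real M ^ ?n * m < A * (lambar * s powr d)"
        using m by (subst (asm) ennreal_less_iff) auto
      \<comment> \<open>Substituting \<open>m\<close> cancels the powers of \<open>4\<close> and
        \<open>M\<close>. The error becomes a multiple of the main term \<open>M ^ n * m\<close>, so
        that \<open>small\<close> applies to their sum.\<close>
      have sd: "(K + 2) ^ ?n * s powr d
          = real M ^ ?n * m * (4 powr d / lam * (K + 2) ^ ?n * real M powr (d - real ?n))"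
        using s KM assms by (simp add: m_def powr_divide powr_diff powr_realpow powr_mult)
      have "A * (lambar * s powr d)
          = lambar * (real M ^ ?n * m * (1 + 2 / K) ^ ?n + (K + 2) ^ ?n * s powr d)"
        using s by (simp add: A_def field_simps)
      also have "\<dots> = real M ^ ?n * m * (lambar * ((1 + 2 / K) ^ ?n
          + 4 powr d / lam * (K + 2) ^ ?n * real M powr (d - real ?n)))"
        unfolding sd by (simp only: algebra_simps)
      also have "\<dots> < real M ^ ?n * m * 1"
        using small m KM by (intro mult_strict_left_mono) auto
      finally show False
        using less by simp
    qed
  qed (use KM in auto)
qed

end
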